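(* Let $\lambda$ be a nonzero real number and let $x,y\in\mathbb{R}$. For every integer $n\ge 0$, \begin{align*} \mathcal{E}_{n,\lambda}^{(c)}(x,y)&=\sum_{k=0}^{n}\binom{n}{k}\mathcal{E}_{k,\lambda}C_{n-k,\lambda}(x,y)\\ &=\sum_{k=0}^{[\frac{n}{2}]}\sum_{l=2k}^{n}\binom{n}{l}\lambda^{l-2k}(-1)^{k}y^{2k}S^{(1)}(l,2k)\mathcal{E}_{n-l,\lambda}(x). \end{align*} Also, for every integer $n\ge 1$, \begin{align*} \mathcal{E}_{n,\lambda}^{(s)}(x,y)&=\sum_{k=0}^{n}\binom{n}{k}\mathcal{E}_{k,\lambda}S_{n-k,\lambda}(x,y)\\ &=\sum_{k=0}^{[\frac{n-1}{2}]}\sum_{l=2k+1}^{n}\binom{n}{l}\lambda^{l-2k-1}(-1)^{k}y^{2k+1}S^{(1)}(l,2k+1)\mathcal{E}_{n-l,\lambda}(x). \end{align*}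
   Context: All generating functions are power series in $t$ around $t=0$. For nonzero $\lambda\in\mathbb{R}$ and complex $z$, the degenerate exponential is $e_\lambda^{z}(t)=(1+\lambda t)^{z/\lambda}$, and $e_\lambda(t)=e_\lambda^1(t)$. The degenerate cosine and sine functions are $\cos_\lambda^{(y)}(t)=\frac{e_\lambda^{iy}(t)+e_\lambda^{-iy}(t)}{2}=\cos\left(\frac{y}{\lambda}\log(1+\lambda t)\right)$ and $\sin_\lambda^{(y)}(t)=\frac{e_\lambda^{iy}(t)-e_\lambda^{-iy}(t)}{2i}=\sin\left(\frac{y}{\lambda}\log(1+\lambda t)\right)$, with $i=\sqrt{-1}$. The degenerate Euler polynomials $\mathcal{E}_{n,\lambda}(x)$ are defined by $\frac{2}{e_\lambda(t)+1}e_\lambda^{x}(t)=\sum_{n=0}^{\infty}\mathcal{E}_{n,\lambda}(x)\frac{t^n}{n!}$, and $\mathcal{E}_{n,\lambda}=\mathcal{E}_{n,\lambda}(0)$. The degenerate cosine-Euler and sine-Euler polynomials are defined by $\frac{2}{e_\lambda(t)+1}e_\lambda^{x}(t)\cos_\lambda^{(y)}(t)=\sum_{n=0}^{\infty}\mathcal{E}_{n,\lambda}^{(c)}(x,y)\frac{t^n}{n!}$ and $\frac{2}{e_\lambda(t)+1}e_\lambda^{x}(t)\sin_\lambda^{(y)}(t)=\sum_{n=0}^{\infty}\mathcal{E}_{n,\lambda}^{(s)}(x,y)\frac{t^n}{n!}$. The degenerate cosine-polynomials and sine-polynomials are defined by $e_\lambda^{x}(t)\cos_\lambda^{(y)}(t)=\sum_{n=0}^{\infty}C_{n,\lambda}(x,y)\frac{t^n}{n!}$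 and $e_\lambda^{x}(t)\sin_\lambda^{(y)}(t)=\sum_{n=0}^{\infty}S_{n,\lambda}(x,y)\frac{t^n}{n!}$. The (signed) Stirling numbers of the first kind $S^{(1)}(n,l)$ are defined by $x(x-1)\cdots(x-n+1)=\sum_{l=0}^{n}S^{(1)}(n,l)x^l$ (the empty product being $1$ for $n=0$). $[a]$ denotes the greatest integer $\le a$. *)

theory Defs
  imports "HOL-Complex_Analysis.Complex_Analysis"
    "HOL-Computational_Algebra.Computational_Algebra"
begin

text \<open>
  The generating functions are functions of a complex variable \<open>t\<close>, analytic near \<open>t = 0\<close>;
  a complex variable is needed because the exponents \<open>\<i> y\<close> are complex.  Consequently all
  number sequences below are complex valued, even for real arguments.
\<close>

definition degenerate_exp :: "real \<Rightarrow> complex \<Rightarrow> complex \<Rightarrow> complex" where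
  "degenerate_exp lam z t = (1 + of_real lam * t) powr (z / of_real lam)"

definition degenerate_cos :: "real \<Rightarrow> real \<Rightarrow> complex \<Rightarrow> complex" where
  "degenerate_cos lam y t =
     (degenerate_exp lam (\<i> * of_real y) t + degenerate_exp lam (- \<i> * of_real y) t) / 2"

definition degenerate_sin :: "real \<Rightarrow> real \<Rightarrow> complex \<Rightarrow> complex" where
  "degenerate_sin lam y t =
     (degenerate_exp lam (\<i> * of_real y) t - degenerate_exp lam (- \<i> * of_real y) t) / (2 * \<i>)"

text \<open>\<open>egf_coeff f n\<close> is the coefficient \<open>a\<^sub>n\<close> in \<open>f t = (\<Sum>n. a\<^sub>n * t ^ n / fact n)\<close> near \<open>t = 0\<close>.\<close>

definition egf_coeff :: "(complex \<Rightarrow> complex) \<Rightarrow> nat \<Rightarrow> complex" where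
  "egf_coeff f n = fact n * fps_nth (fps_expansion f 0) n"

definition degenerate_Euler_poly :: "real \<Rightarrow> nat \<Rightarrow> real \<Rightarrow> complex" where
  "degenerate_Euler_poly lam n x =
     egf_coeff (\<lambda>t. 2 / (degenerate_exp lam 1 t + 1) * degenerate_exp lam (of_real x) t) n"

definition degenerate_Euler_number :: "real \<Rightarrow> nat \<Rightarrow> complex" where
  "degenerate_Euler_number lam n = degenerate_Euler_poly lam n 0"

definition degenerate_cos_Euler_poly :: "real \<Rightarrow> nat \<Rightarrow> real \<Rightarrow> real \<Rightarrow> complex" where
  "degenerate_cos_Euler_poly lam n x y =
     egf_coeff (\<lambda>t. 2 / (degenerate_exp lam 1 t + 1) * degenerate_exp lam (of_real x) t
                      * degenerate_cos lam y t) n"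

definition degenerate_sin_Euler_poly :: "real \<Rightarrow> nat \<Rightarrow> real \<Rightarrow> real \<Rightarrow> complex" where
  "degenerate_sin_Euler_poly lam n x y =
     egf_coeff (\<lambda>t. 2 / (degenerate_exp lam 1 t + 1) * degenerate_exp lam (of_real x) t
                      * degenerate_sin lam y t) n"

definition degenerate_cos_poly :: "real \<Rightarrow> nat \<Rightarrow> real \<Rightarrow> real \<Rightarrow> complex" where
  "degenerate_cos_poly lam n x y =
     egf_coeff (\<lambda>t. degenerate_exp lam (of_real x) t * degenerate_cos lam y t) n"

definition degenerate_sin_poly :: "real \<Rightarrow> nat \<Rightarrow> real \<Rightarrow> real \<Rightarrow> complex" where
  "degenerate_sin_poly lam n x y =
     egf_coeff (\<lambda>t. degenerate_exp lam (of_real x) t * degenerate_sin lam y t) n"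

text \<open>Signed Stirling numbers of the first kind; the library's \<open>stirling\<close> is the unsigned version.\<close>

definition signed_stirling1 :: "nat \<Rightarrow> nat \<Rightarrow> int" where
  "signed_stirling1 n l = coeff (\<Prod>i<n. [:- of_nat i, 1:]) l"

lemma falling_factorial_eq_signed_stirling1:
  fixes x :: int
  shows "(\<Prod>i<n. x - of_nat i) = (\<Sum>l\<le>n. signed_stirling1 n l * x ^ l)"
proof -
  let ?p = "\<Prod>i<n. [:- of_nat i, 1:] :: int poly"
  have "degree ?p \<le> (\<Sum>i<n. degree [:- of_nat i, 1 :: int:])"
    using degree_prod_sum_le[of "{..<n}" "\<lambda>i. [:- of_nat i, 1 :: int:]"] by (simp add: o_def)
  then have deg: "degree ?p \<le> n" by simp
  have "(\<Prod>i<n. x - of_nat i) = poly ?p x"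
    by (simp add: poly_prod)
  also have "\<dots> = (\<Sum>l\<le>n. coeff ?p l * x ^ l)"
    by (subst poly_as_sum_of_monoms'[OF deg, symmetric]) (simp add: poly_sum poly_monom)
  finally show ?thesis by (simp add: signed_stirling1_def)
qed

lemma degenerate_cos_eq_cos:
  assumes "1 + of_real lam * t \<noteq> 0"
  shows "degenerate_cos lam y t = cos (of_real y / of_real lam * Ln (1 + of_real lam * t))"
  using assms by (simp add: degenerate_cos_def degenerate_exp_def powr_def cos_exp_eq mult_ac)

lemma degenerate_sin_eq_sin:
  assumes "1 + of_real lam * t \<noteq> 0"
  shows "degenerate_sin lam y t = sin (of_real y / of_real lam * Ln (1 + of_real lam * t))"
  using assms by (simp add: degenerate_sin_def degenerate_exp_def powr_def sin_exp_eq mult_ac)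

lemma egf_coeff_has_fps_expansion:
  assumes "f analytic_on {0}"
  shows "f has_fps_expansion Abs_fps (\<lambda>n. egf_coeff f n / fact n)"
proof -
  have "Abs_fps (\<lambda>n. egf_coeff f n / fact n) = fps_expansion f 0"
    by (simp add: fps_eq_iff egf_coeff_def)
  then show ?thesis
    using analytic_at_imp_has_fps_expansion_0[OF assms] by simp
qed

lemma analytic_degenerate_exp: "degenerate_exp lam z analytic_on {0}"
  unfolding degenerate_exp_def by (cases "lam = 0") (auto intro!: analytic_intros)

lemma analytic_degenerate_cos: "degenerate_cos lam y analytic_on {0}"
  unfolding degenerate_cos_def by (intro analytic_intros analytic_degenerate_exp) auto

lemma analytic_degenerate_sin: "degenerate_sin lam y analytic_on {0}"
  unfolding degenerate_sin_def by (intro analytic_intros analytic_degenerate_exp) auto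

lemma analytic_degenerate_Euler_kernel:
  "(\<lambda>t. 2 / (degenerate_exp lam 1 t + 1)) analytic_on {0}"
  by (intro analytic_intros analytic_degenerate_exp) (auto simp: degenerate_exp_def)

end

theory Submission
  imports Defs
begin

text \<open>
  Multiplying exponential generating functions convolves their coefficients binomially, which gives
  the first equality in each line.  For the second, \<open>(1 + \<lambda>t)\<^bsup>z/\<lambda>\<^esup>\<close> has
  the coefficients \<open>z (z - \<lambda>) \<cdots> (z - (n - 1) \<lambda>)\<close>, which are polynomials in \<open>z\<close> given by the
  Stirling numbers.  At \<open>z = \<plusminus>\<i>y\<close> the cosine keeps exactly their even powers of \<open>z\<close>
  and the sine the odd ones.
\<close>

section \<open>Exponential coefficients: linearity and binomial convolution\<close>

lemma egf_coeff_eqI: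
  assumes "f has_fps_expansion F"
  shows "egf_coeff f n = fact n * fps_nth F n"
  using fps_expansion_eqI[OF assms] by (simp add: egf_coeff_def)

lemma egf_coeff_mult:
  assumes "f analytic_on {0}" and "g analytic_on {0}"
  shows "egf_coeff (\<lambda>t. f t * g t) n =
    (\<Sum>k=0..n. of_nat (n choose k) * egf_coeff f k * egf_coeff g (n - k))"
proof -
  have "egf_coeff (\<lambda>t. f t * g t) n =
      fact n * fps_nth (fps_expansion f 0 * fps_expansion g 0) n"
    using assms by (intro egf_coeff_eqI has_fps_expansion_mult analytic_at_imp_has_fps_expansion_0)
  also have "\<dots> = (\<Sum>k=0..n. of_nat (n choose k) * egf_coeff f k * egf_coeff g (n - k))"
    by (auto simp: fps_mult_nth sum_distrib_left egf_coeff_def binomial_fact intro!: sum.cong)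
  finally show ?thesis .
qed

text \<open>Products are written with the Euler factor first. Here the summation index falls on the
  second factor, so that \<open>n - l\<close> is left for the Euler polynomial.\<close>

lemma egf_coeff_mult_flip:
  assumes "f analytic_on {0}" and "g analytic_on {0}"
  shows "egf_coeff (\<lambda>t. f t * g t) n =
    (\<Sum>l=0..n. of_nat (n choose l) * egf_coeff g l * egf_coeff f (n - l))"
  using egf_coeff_mult[OF assms(2,1)] by (simp add: mult.commute)

lemma egf_coeff_add:
  assumes "f analytic_on {0}" and "g analytic_on {0}"
  shows "egf_coeff (\<lambda>t. f t + g t) n = egf_coeff f n + egf_coeff g n"
proof -
  have "egf_coeff (\<lambda>t. f t + g t) n = fact n * fps_nth (fps_expansion f 0 + fps_expansion g 0) n"
    using assms by (intro egf_coeff_eqI has_fps_expansion_add analytic_at_imp_has_fps_expansion_0)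
  then show ?thesis by (simp add: egf_coeff_def algebra_simps)
qed

lemma egf_coeff_cmult:
  assumes "f analytic_on {0}"
  shows "egf_coeff (\<lambda>t. c * f t) n = c * egf_coeff f n"
proof -
  have "egf_coeff (\<lambda>t. c * f t) n = fact n * fps_nth (fps_const c * fps_expansion f 0) n"
    using assms
    by (intro egf_coeff_eqI has_fps_expansion_cmult_left analytic_at_imp_has_fps_expansion_0)
  then show ?thesis by (simp add: egf_coeff_def)
qed

section \<open>Coefficients of the degenerate exponential\<close>

lemma egf_coeff_degenerate_exp_prod:
  assumes "lam \<noteq> 0"
  shows "egf_coeff (degenerate_exp lam z) n = (\<Prod>i<n. z - of_nat i * of_real lam)"
proof -
  \<comment> \<open>This is the binomial series of (1 + w)^(z/lam) at w = lam t; it converges for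
    |w| < 1, which gives the radius 1/|lam| below.\<close>
  define F where "F = Abs_fps (\<lambda>n. (z / of_real lam gchoose n) * of_real lam ^ n)"
  have "eventually (\<lambda>t::complex. t \<in> ball 0 (1 / \<bar>lam\<bar>)) (nhds 0)"
    using assms by (intro eventually_nhds_in_open) auto
  then have "eventually (\<lambda>t. (\<lambda>n. fps_nth F n * t ^ n) sums degenerate_exp lam z t) (nhds 0)"
  proof eventually_elim
    case (elim t)
    then have "norm (of_real lam * t) < 1"
      using assms by (simp add: norm_mult field_simps)
    from gen_binomial_complex[OF this, of "z / of_real lam"] show ?case
      by (simp add: F_def degenerate_exp_def power_mult_distrib mult.assoc)
  qed
  then have "egf_coeff (degenerate_exp lam z) n = fact n * fps_nth F n"
    by (intro egf_coeff_eqI has_fps_expansionI)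
  also have "\<dots> = (\<Prod>i<n. z / of_real lam - of_nat i) * of_real lam ^ n"
    by (simp add: F_def gbinomial_prod_rev atLeast0LessThan)
  \<comment> \<open>Each of the n factors receives one of the n copies of lam, which clears its
    denominator.\<close>
  also have "\<dots> = (\<Prod>i<n. (z / of_real lam - of_nat i) * of_real lam)"
    by (simp add: prod.distrib)
  also have "\<dots> = (\<Prod>i<n. z - of_nat i * of_real lam)"
    using assms by (intro prod.cong) (auto simp: field_simps)
  finally show ?thesis .
qed

text \<open>Splits off the last linear factor X - n of the defining product: multiplication by X
  shifts coefficients by one.\<close>

lemma signed_stirling1_Suc_Suc:
  "signed_stirling1 (Suc n) (Suc l) = signed_stirling1 n l - int n * signed_stirling1 n (Suc l)"
  by (simp add: signed_stirling1_def lessThan_Suc mult.commute)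

lemma signed_stirling1_Suc_0: "signed_stirling1 (Suc n) 0 = - int n * signed_stirling1 n 0"
  by (simp add: signed_stirling1_def mult.commute)

lemma signed_stirling1_eq_0:
  assumes "n < l"
  shows "signed_stirling1 n l = 0"
  using assms
proof (induction n arbitrary: l)
  case 0
  then show ?case by (simp add: signed_stirling1_def)
next
  case (Suc n)
  then show ?case by (cases l) (auto simp: signed_stirling1_Suc_Suc)
qed

text \<open>The homogeneous form of the defining expansion. The induction multiplies by z - n a and
  matches powers of z through the Stirling recurrence.\<close>

lemma prod_diff_eq_signed_stirling1:
  fixes z a :: "'a::comm_ring_1"
  shows "(\<Prod>i<n. z - of_nat i * a) =
    (\<Sum>j\<le>n. of_int (signed_stirling1 n j) * a ^ (n - j) * z ^ j)"
proof (induction n)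
  case 0
  then show ?case by (simp add: signed_stirling1_def)
next
  case (Suc n)
  let ?s = "\<lambda>n j. of_int (signed_stirling1 n j) :: 'a"
  \<comment> \<open>The z part of the new factor produces powers \<open>z ^ Suc j\<close>. To match
    them, the a part is extended to j = Suc n, where the Stirling number vanishes, and its term j =
    0 is split off.\<close>
  have shift: "a * (\<Sum>j\<le>n. ?s n j * a ^ (n - j) * z ^ j) =
      ?s n 0 * a ^ Suc n + (\<Sum>j\<le>n. ?s n (Suc j) * a ^ (n - j) * z ^ Suc j)"
  proof -
    have "a * (\<Sum>j\<le>n. ?s n j * a ^ (n - j) * z ^ j) = (\<Sum>j\<le>n. ?s n j * a ^ (Suc n - j) * z ^ j)"
      unfolding sum_distrib_left by (rule sum.cong) (auto simp: Suc_diff_le algebra_simps)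
    also have "\<dots> = (\<Sum>j\<le>Suc n. ?s n j * a ^ (Suc n - j) * z ^ j)"
      by (simp add: signed_stirling1_eq_0)
    also have "\<dots> = ?s n 0 * a ^ Suc n + (\<Sum>j\<le>n. ?s n (Suc j) * a ^ (n - j) * z ^ Suc j)"
      by (subst sum.atMost_Suc_shift) simp
    finally show ?thesis .
  qed
  have "(\<Prod>i<Suc n. z - of_nat i * a) =
      (\<Sum>j\<le>n. ?s n j * a ^ (n - j) * z ^ j) * z - of_nat n * (a * (\<Sum>j\<le>n. ?s n j * a ^ (n - j) * z ^ j))"
    by (simp only: prod.lessThan_Suc Suc.IH) (simp add: algebra_simps)
  also have "\<dots> = (\<Sum>j\<le>n. ?s n j * a ^ (n - j) * z ^ Suc j)
      - of_nat n * (?s n 0 * a ^ Suc n + (\<Sum>j\<le>n. ?s n (Suc j) * a ^ (n - j) * z ^ Suc j))"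
    unfolding shift by (simp add: sum_distrib_right sum_distrib_left mult_ac)
  also have "\<dots> = ?s (Suc n) 0 * a ^ Suc n + (\<Sum>j\<le>n. ?s (Suc n) (Suc j) * a ^ (n - j) * z ^ Suc j)"
    by (simp add: signed_stirling1_Suc_0 signed_stirling1_Suc_Suc ring_distribs sum_subtractf
        sum_distrib_left mult_ac)
  also have "\<dots> = (\<Sum>j\<le>Suc n. ?s (Suc n) j * a ^ (Suc n - j) * z ^ j)"
    by (subst sum.atMost_Suc_shift) simp
  finally show ?case .
qed

lemma egf_coeff_degenerate_exp:
  assumes "lam \<noteq> 0"
  shows "egf_coeff (degenerate_exp lam z) n =
    (\<Sum>j\<le>n. of_int (signed_stirling1 n j) * of_real lam ^ (n - j) * z ^ j)"
  using assms by (simp add: egf_coeff_degenerate_exp_prod prod_diff_eq_signed_stirling1)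

section \<open>Even and odd powers: the cosine and the sine\<close>

lemma imaginary_power_plus:
  "((\<i> * w) ^ j + (- \<i> * w) ^ j) / 2 = (if even j then (-1) ^ (j div 2) * w ^ j else 0)"
  by (auto elim!: evenE oddE simp: power_mult_distrib power_mult)

text \<open>For j = 2k + 1 the two powers are opposite and \<i>^j = (-1)^k \<i>; this last \<i>
  cancels against the denominator. For even j the powers agree.\<close>

lemma imaginary_power_minus:
  "((\<i> * w) ^ j - (- \<i> * w) ^ j) / (2 * \<i>) = (if odd j then (-1) ^ (j div 2) * w ^ j else 0)"
  by (auto elim!: evenE oddE simp: power_mult_distrib power_mult mult.assoc complex_i_mult_minus)

lemma egf_coeff_degenerate_cos:
  assumes "lam \<noteq> 0"
  shows "egf_coeff (degenerate_cos lam y) n =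
    (\<Sum>j\<le>n. if even j then of_real lam ^ (n - j) * (-1) ^ (j div 2) * of_real y ^ j
                           * of_int (signed_stirling1 n j) else 0)"
proof -
  have "egf_coeff (degenerate_cos lam y) n =
      egf_coeff (\<lambda>t. (1/2) * (degenerate_exp lam (\<i> * y) t + degenerate_exp lam (- \<i> * y) t)) n"
    by (simp add: degenerate_cos_def[abs_def] add_divide_distrib)
  also have "\<dots> = (1/2) * (egf_coeff (degenerate_exp lam (\<i> * y)) n
      + egf_coeff (degenerate_exp lam (- \<i> * y)) n)"
    by (simp only: egf_coeff_cmult egf_coeff_add analytic_degenerate_exp analytic_on_add)
  also have "\<dots> = (\<Sum>j\<le>n. of_int (signed_stirling1 n j) * of_real lam ^ (n - j)
      * (((\<i> * y) ^ j + (- \<i> * y) ^ j) / 2))"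
    using assms by (simp add: egf_coeff_degenerate_exp sum_distrib_left ring_distribs sum.distrib
      add_divide_distrib)
  finally show ?thesis
    unfolding imaginary_power_plus by (auto intro!: sum.cong)
qed

lemma egf_coeff_degenerate_sin:
  assumes "lam \<noteq> 0"
  shows "egf_coeff (degenerate_sin lam y) n =
    (\<Sum>j\<le>n. if odd j then of_real lam ^ (n - j) * (-1) ^ (j div 2) * of_real y ^ j
                           * of_int (signed_stirling1 n j) else 0)"
proof -
  \<comment> \<open>The difference becomes a sum with a factor -1, to which additivity and scaling
    apply.\<close>
  have "egf_coeff (degenerate_sin lam y) n =
      egf_coeff (\<lambda>t. (1/(2*\<i>)) * (degenerate_exp lam (\<i> * y) t
                      + (-1) * degenerate_exp lam (- \<i> * y) t)) n"
    by (simp add: degenerate_sin_def[abs_def])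
  also have "\<dots> = (1/(2*\<i>)) * (egf_coeff (degenerate_exp lam (\<i> * y)) n
      + (-1) * egf_coeff (degenerate_exp lam (- \<i> * y)) n)"
    by (simp only: egf_coeff_cmult egf_coeff_add analytic_degenerate_exp analytic_on_add
        analytic_on_mult analytic_on_const)
  also have "\<dots> = (\<Sum>j\<le>n. of_int (signed_stirling1 n j) * of_real lam ^ (n - j)
      * (((\<i> * y) ^ j - (- \<i> * y) ^ j) / (2 * \<i>)))"
    unfolding egf_coeff_degenerate_exp[OF assms] sum_distrib_left sum.distrib[symmetric]
    by (intro sum.cong) (auto simp: algebra_simps diff_divide_distrib)
  finally show ?thesis
    unfolding imaginary_power_minus by (auto intro!: sum.cong)
qed

section \<open>Interchanging sums over a triangle\<close>

lemma sum_lower_triangle_swap: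
  fixes G :: "nat \<Rightarrow> nat \<Rightarrow> 'a::comm_monoid_add"
  shows "(\<Sum>l=0..n. \<Sum>j\<le>l. if P j then G l j else 0) = (\<Sum>j | j \<le> n \<and> P j. \<Sum>l=j..n. G l j)"
proof -
  \<comment> \<open>The range j \<le> l, which depends on l, becomes a relation on a fixed square,
    where the two sums can be swapped.\<close>
  have "(\<Sum>l=0..n. \<Sum>j\<le>l. if P j then G l j else 0) =
      (\<Sum>l\<in>{0..n}. \<Sum>j | j \<in> {..n} \<and> (j \<le> l \<and> P j). G l j)"
    unfolding sum.inter_filter[OF finite_atMost, symmetric]
    by (intro sum.cong) auto
  also have "\<dots> = (\<Sum>j\<le>n. \<Sum>l | l \<in> {0..n} \<and> (j \<le> l \<and> P j). G l j)"
    by (rule sum.swap_restrict) auto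
  also have "\<dots> = (\<Sum>j\<le>n. if P j then (\<Sum>l=j..n. G l j) else 0)"
    by (intro sum.cong) (auto intro!: sum.cong)
  also have "\<dots> = (\<Sum>j | j \<le> n \<and> P j. \<Sum>l=j..n. G l j)"
    using sum.inter_filter[of "{..n}" "\<lambda>j. \<Sum>l=j..n. G l j" P] by simp
  finally show ?thesis .
qed

lemma sum_lower_triangle_even:
  fixes G :: "nat \<Rightarrow> nat \<Rightarrow> 'a::comm_monoid_add"
  shows "(\<Sum>l=0..n. \<Sum>j\<le>l. if even j then G l j else 0) =
    (\<Sum>k=0..n div 2. \<Sum>l=2*k..n. G l (2*k))"
  unfolding sum_lower_triangle_swap
  by (rule sum.reindex_bij_witness[where i="\<lambda>k. 2 * k" and j="\<lambda>j. j div 2"]) auto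

text \<open>The odd j \<le> n are the 2k + 1 with k \<le> (n - 1) div 2. The bijection uses n \<ge>
  1: at n = 0 truncated subtraction would admit k = 0, although 1 > n.\<close>

lemma sum_lower_triangle_odd:
  fixes G :: "nat \<Rightarrow> nat \<Rightarrow> 'a::comm_monoid_add"
  assumes "n \<ge> 1"
  shows "(\<Sum>l=0..n. \<Sum>j\<le>l. if odd j then G l j else 0) =
    (\<Sum>k=0..(n - 1) div 2. \<Sum>l=2*k+1..n. G l (2*k+1))"
  unfolding sum_lower_triangle_swap
  by (rule sum.reindex_bij_witness[where i="\<lambda>k. 2 * k + 1" and j="\<lambda>j. j div 2"])
    (use assms in \<open>auto elim!: oddE\<close>)

section \<open>Degenerate Euler numbers and the four identities\<close>

lemma degenerate_Euler_number_eq: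
  assumes "lam \<noteq> 0"
  shows "degenerate_Euler_number lam n = egf_coeff (\<lambda>t. 2 / (degenerate_exp lam 1 t + 1)) n"
proof -
  \<comment> \<open>For z = 0 and k > 0 the product has the factor 0 at i = 0. Coefficients are
    compared because \<open>0 powr 0 = 0\<close> keeps the function from being 1 everywhere.\<close>
  have "egf_coeff (degenerate_exp lam 0) = (\<lambda>k. if k = 0 then 1 else 0)"
    using assms by (auto simp: egf_coeff_degenerate_exp_prod)
  then show ?thesis
    unfolding degenerate_Euler_number_def degenerate_Euler_poly_def of_real_0
    by (subst egf_coeff_mult_flip[OF analytic_degenerate_Euler_kernel analytic_degenerate_exp])
      (simp add: if_distrib if_distribR cong: if_cong)
qed

theorem theorem2p3:
  fixes lam x y :: real
  assumes "lam \<noteq> 0"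
  shows "(\<forall>n::nat.
            degenerate_cos_Euler_poly lam n x y =
              (\<Sum>k=0..n. of_nat (n choose k) * degenerate_Euler_number lam k
                           * degenerate_cos_poly lam (n - k) x y)
          \<and> (\<Sum>k=0..n. of_nat (n choose k) * degenerate_Euler_number lam k
                           * degenerate_cos_poly lam (n - k) x y) =
              (\<Sum>k=0..n div 2. \<Sum>l=2*k..n.
                 of_nat (n choose l) * of_real lam ^ (l - 2*k) * (-1) ^ k * of_real y ^ (2*k)
                   * of_int (signed_stirling1 l (2*k)) * degenerate_Euler_poly lam (n - l) x))
       \<and> (\<forall>n::nat. n \<ge> 1 \<longrightarrow>
            degenerate_sin_Euler_poly lam n x y =
              (\<Sum>k=0..n. of_nat (n choose k) * degenerate_Euler_number lam k
                           * degenerate_sin_poly lam (n - k) x y)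
          \<and> (\<Sum>k=0..n. of_nat (n choose k) * degenerate_Euler_number lam k
                           * degenerate_sin_poly lam (n - k) x y) =
              (\<Sum>k=0..(n - 1) div 2. \<Sum>l=2*k+1..n.
                 of_nat (n choose l) * of_real lam ^ (l - 2*k - 1) * (-1) ^ k
                   * of_real y ^ (2*k+1) * of_int (signed_stirling1 l (2*k+1))
                   * degenerate_Euler_poly lam (n - l) x))"
proof -
  note analytic = analytic_degenerate_Euler_kernel analytic_degenerate_exp analytic_degenerate_cos
    analytic_degenerate_sin analytic_on_mult
  note number = degenerate_Euler_number_eq[OF assms]
  \<comment> \<open>Reassociating isolates the kernel 2/(e + 1) as the first factor; its
    coefficients are the Euler numbers.\<close>
  have cos1: "degenerate_cos_Euler_poly lam n x y =
      (\<Sum>k=0..n. of_nat (n choose k) * degenerate_Euler_number lam k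
                   * degenerate_cos_poly lam (n - k) x y)" for n
    unfolding degenerate_cos_Euler_poly_def degenerate_cos_poly_def number mult.assoc[of "2 / _"]
    by (intro egf_coeff_mult analytic)
  have sin1: "degenerate_sin_Euler_poly lam n x y =
      (\<Sum>k=0..n. of_nat (n choose k) * degenerate_Euler_number lam k
                   * degenerate_sin_poly lam (n - k) x y)" for n
    unfolding degenerate_sin_Euler_poly_def degenerate_sin_poly_def number mult.assoc[of "2 / _"]
    by (intro egf_coeff_mult analytic)
  have cos2: "degenerate_cos_Euler_poly lam n x y =
      (\<Sum>k=0..n div 2. \<Sum>l=2*k..n.
         of_nat (n choose l) * of_real lam ^ (l - 2*k) * (-1) ^ k * of_real y ^ (2*k)
           * of_int (signed_stirling1 l (2*k)) * degenerate_Euler_poly lam (n - l) x)" for n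
  proof -
    \<comment> \<open>Here the kernel stays grouped with e^x, giving Euler polynomials. The sign
      exponent \<open>j div 2\<close> becomes k once j = 2k is substituted.\<close>
    let ?G = "\<lambda>l j. of_nat (n choose l) * of_real lam ^ (l - j) * (-1) ^ (j div 2) * of_real y ^ j
      * of_int (signed_stirling1 l j) * degenerate_Euler_poly lam (n - l) x"
    have "degenerate_cos_Euler_poly lam n x y =
        (\<Sum>l=0..n. of_nat (n choose l) * egf_coeff (degenerate_cos lam y) l
                     * degenerate_Euler_poly lam (n - l) x)"
      unfolding degenerate_cos_Euler_poly_def degenerate_Euler_poly_def
      by (intro egf_coeff_mult_flip analytic)
    also have "\<dots> = (\<Sum>l=0..n. \<Sum>j\<le>l. if even j then ?G l j else 0)"
      unfolding egf_coeff_degenerate_cos[OF assms] sum_distrib_left sum_distrib_right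
      by (intro sum.cong) (auto simp: mult_ac)
    finally show ?thesis
      unfolding sum_lower_triangle_even by simp
  qed
  have sin2: "degenerate_sin_Euler_poly lam n x y =
      (\<Sum>k=0..(n - 1) div 2. \<Sum>l=2*k+1..n.
         of_nat (n choose l) * of_real lam ^ (l - 2*k - 1) * (-1) ^ k
           * of_real y ^ (2*k+1) * of_int (signed_stirling1 l (2*k+1))
           * degenerate_Euler_poly lam (n - l) x)" if "n \<ge> 1" for n
  proof -
    let ?G = "\<lambda>l j. of_nat (n choose l) * of_real lam ^ (l - j) * (-1) ^ (j div 2) * of_real y ^ j
      * of_int (signed_stirling1 l j) * degenerate_Euler_poly lam (n - l) x"
    have "degenerate_sin_Euler_poly lam n x y =
        (\<Sum>l=0..n. of_nat (n choose l) * egf_coeff (degenerate_sin lam y) l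
                     * degenerate_Euler_poly lam (n - l) x)"
      unfolding degenerate_sin_Euler_poly_def degenerate_Euler_poly_def
      by (intro egf_coeff_mult_flip analytic)
    also have "\<dots> = (\<Sum>l=0..n. \<Sum>j\<le>l. if odd j then ?G l j else 0)"
      unfolding egf_coeff_degenerate_sin[OF assms] sum_distrib_left sum_distrib_right
      by (intro sum.cong) (auto simp: mult_ac)
    finally show ?thesis
      unfolding sum_lower_triangle_odd[OF that] by simp
  qed
  \<comment> \<open>The second equality in each chain compares two expansions of the same Euler-type
    polynomial.\<close>
  show ?thesis
    by (intro conjI allI impI cos1[symmetric, THEN trans] sin1[symmetric, THEN trans]
        cos1 sin1 cos2 sin2)
qed

end
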